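(* Let $\mathcal{P}_{\mathsf c}$ be the countable powerset functor on $\mathbf{Set}$. For every positive limit ordinal $i<\omega_1$, some element of $\nu^{(i)}\mathcal{P}_{\mathsf c}$ has $2^{\aleph_0}$ successors.
   Context: Work in ZFC. $\mathcal{P}_{\mathsf c}X$ is the set of countable (finite or countably infinite) subsets of $X$; it is a functor via direct image. $0$ is deemed a limit ordinal. Final chain of an endofunctor $F$ on $\mathbf{Set}$: sets $\nu^{(i)}F$ for all ordinals $i$, with functorial connecting maps $\nu^{(i\geqslant j)}:\nu^{(i)}F\to\nu^{(j)}F$ for $j\leqslant i$, determined by: $\nu^{(i+1)}F=F\nu^{(i)}F$ and $\nu^{(i+1\geqslant j+1)}=F\nu^{(i\geqslant j)}$; for $i$ a limit, $\nu^{(i)}F$ is the set of families $(x_j)_{j<i}$ with $x_j\in\nu^{(j)}F$ and $\nu^{(j\geqslant k)}x_j=x_k$ for $k\leqslant j<i$, and $\nu^{(i\geqslant j)}x=x_j$ for $j<i$. So $\nu^{(0)}F=\{()\}$. For a limit $i$ and $a,b\in\nu^{(i)}\mathcal{P}_{\mathsf c}$, $b$ is a successor of $a$ when $b_j\in a_{j+1}$ for all $j<i$. *)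

theory Defs
  imports
    "HOL-Library.Countable_Set_Type"
    "HOL-Library.FuncSet"
    "HOL-Library.Equipollence"
begin

section \<open>Countable ordinals\<close>

text \<open>
  The elements of this type are the ordinals below \<open>\<omega>\<^sub>1\<close>: it is the initial
  well-order of cardinality \<open>\<aleph>\<^sub>0\<^sup>+\<close>, where \<^const>\<open>natLeq\<close> represents \<open>\<aleph>\<^sub>0\<close>.
\<close>

typedef omega1 = "Field (cardSuc natLeq)"
proof -
  have "infinite (Field (cardSuc natLeq))"
    using cardSuc_finite[OF natLeq_Card_order] by (simp add: Field_natLeq)
  then show ?thesis
    by (metis ex_in_conv finite.emptyI)
qed

lemma Well_order_omega1: "Well_order (cardSuc natLeq)"
  using cardSuc_Card_order[OF natLeq_Card_order] by (simp add: card_order_on_def)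

instantiation omega1 :: linorder
begin

definition less_eq_omega1 :: "omega1 \<Rightarrow> omega1 \<Rightarrow> bool" where
  "i \<le> j \<longleftrightarrow> (Rep_omega1 i, Rep_omega1 j) \<in> cardSuc natLeq"

definition less_omega1 :: "omega1 \<Rightarrow> omega1 \<Rightarrow> bool" where
  "(i :: omega1) < j \<longleftrightarrow> i \<le> j \<and> i \<noteq> j"

instance
proof
  let ?r = "cardSuc natLeq"
  have r: "refl_on (Field ?r) ?r" "trans ?r" "antisym ?r" "total_on (Field ?r) ?r"
    using Well_order_omega1 by (auto simp: order_on_defs well_order_on_def)
  fix i j k :: omega1
  show le: "i \<le> i"
    using r(1) Rep_omega1 by (auto simp: less_eq_omega1_def refl_on_def)
  show "i \<le> j \<Longrightarrow> j \<le> k \<Longrightarrow> i \<le> k"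
    using r(2) unfolding less_eq_omega1_def by (rule transD)
  show anti: "i \<le> j \<Longrightarrow> j \<le> i \<Longrightarrow> i = j"
    using r(3) unfolding less_eq_omega1_def by (metis antisymD Rep_omega1_inject)
  show "i < j \<longleftrightarrow> i \<le> j \<and> \<not> j \<le> i"
    using le anti by (auto simp: less_omega1_def)
  show "i \<le> j \<or> j \<le> i"
  proof (cases "i = j")
    case True
    then show ?thesis using r(1) Rep_omega1 by (auto simp: less_eq_omega1_def refl_on_def)
  next
    case False
    then show ?thesis
      using r(4) Rep_omega1 Rep_omega1_inject by (auto simp: less_eq_omega1_def total_on_def)
  qed
qed

end

instance omega1 :: wellorder
proof
  have "wf (cardSuc natLeq - Id)"
    using Well_order_omega1 by (simp add: well_order_on_def)
  fix P :: "omega1 \<Rightarrow> bool" and a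
  assume step: "\<And>x. (\<And>y. y < x \<Longrightarrow> P y) \<Longrightarrow> P x"
  have "wf {(i, j :: omega1). i < j}"
    by (rule wf_subset[OF wf_inv_image[OF \<open>wf (cardSuc natLeq - Id)\<close>, of Rep_omega1]])
      (auto simp: inv_image_def less_omega1_def less_eq_omega1_def Rep_omega1_inject)
  then show "P a"
    by (induction rule: wf_induct_rule) (auto intro: step)
qed

instantiation omega1 :: zero
begin
definition zero_omega1 :: omega1 where "0 = (LEAST i :: omega1. True)"
instance ..
end

lemma omega1_zero_le [simp]: "0 \<le> (i :: omega1)"
  by (simp add: zero_omega1_def Least_le)

lemma countable_omega1_below: "countable {..<i :: omega1}"
proof -
  include cardinal_syntax
  let ?r = "cardSuc natLeq"
  have "|underS ?r (Rep_omega1 i)| <o ?r"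
    by (rule card_of_underS[OF cardSuc_Card_order[OF natLeq_Card_order] Rep_omega1])
  then have "countable (underS ?r (Rep_omega1 i))"
    by (simp add: countable_card_le_natLeq cardSuc_ordLeq_ordLess natLeq_Card_order
        card_of_Card_order)
  moreover have "Rep_omega1 ` {..<i} \<subseteq> underS ?r (Rep_omega1 i)"
    by (auto simp: underS_def less_omega1_def less_eq_omega1_def Rep_omega1_inject)
  ultimately show ?thesis
    by (metis countable_image_inj_on countable_subset inj_on_def Rep_omega1_inject)
qed

lemma uncountable_omega1: "uncountable (UNIV :: omega1 set)"
proof
  include cardinal_syntax
  assume "countable (UNIV :: omega1 set)"
  then have "countable (range Rep_omega1)" by (rule countable_image)
  then have "countable (Field (cardSuc natLeq))"
    by (simp add: type_definition.Rep_range[OF type_definition_omega1])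
  then have "|Field (cardSuc natLeq)| \<le>o natLeq"
    by (simp add: countable_card_le_natLeq)
  moreover have "|Field (cardSuc natLeq)| =o cardSuc natLeq"
    by (rule card_of_Field_ordIso[OF cardSuc_Card_order[OF natLeq_Card_order]])
  ultimately have "cardSuc natLeq \<le>o natLeq"
    using ordIso_ordLeq_trans ordIso_symmetric by blast
  then show False
    using cardSuc_greater[OF natLeq_Card_order] not_ordLess_ordLeq by blast
qed

lemma omega1_no_top: "\<exists>j. (i :: omega1) < j"
proof (rule ccontr)
  assume "\<not> ?thesis"
  then have "(UNIV :: omega1 set) = insert i {..<i}" by (auto simp: not_less order.order_iff_strict)
  then show False
    using uncountable_omega1 countable_omega1_below[of i] by (metis countable_insert)
qed

definition osucc :: "omega1 \<Rightarrow> omega1" where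
  "osucc i = (LEAST j. i < j)"

definition opred :: "omega1 \<Rightarrow> omega1" where
  "opred i = (THE j. i = osucc j)"

definition limit :: "omega1 \<Rightarrow> bool" where
  "limit i \<longleftrightarrow> (\<nexists>j. i = osucc j)"

lemma less_osucc [simp]: "i < osucc i"
  unfolding osucc_def by (rule LeastI_ex[OF omega1_no_top])

lemma osucc_le_iff [simp]: "osucc i \<le> j \<longleftrightarrow> i < j"
  by (metis Least_le less_le_trans less_osucc osucc_def)

lemma less_osucc_iff [simp]: "j < osucc i \<longleftrightarrow> j \<le> i"
  by (metis linorder_not_le osucc_le_iff)

lemma osucc_less_iff [simp]: "osucc i < osucc j \<longleftrightarrow> i < j"
  by simp

lemma osucc_inject [simp]: "osucc i = osucc j \<longleftrightarrow> i = j"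
  by (metis less_osucc less_osucc_iff order.antisym)

lemma opred_osucc [simp]: "opred (osucc i) = i"
  by (simp add: opred_def)

lemma not_limit_osucc [simp]: "\<not> limit (osucc i)"
  by (auto simp: limit_def)

lemma limit_zero: "limit 0"
  by (metis limit_def less_osucc omega1_zero_le leD)

lemma not_limitE: "\<not> limit i \<Longrightarrow> (\<And>j. i = osucc j \<Longrightarrow> thesis) \<Longrightarrow> thesis"
  by (auto simp: limit_def)

lemma opred_less: "\<not> limit i \<Longrightarrow> opred i < i"
  by (erule not_limitE) simp

lemma limit_osucc_less: "limit i \<Longrightarrow> j < i \<Longrightarrow> osucc j < i"
  by (metis limit_def order.not_eq_order_implies_strict osucc_le_iff)


section \<open>The final chain of the countable powerset functor\<close>

text \<open>
  A common type containing all \<open>\<nu>\<^sup>(\<^sup>i\<^sup>)\<close> for \<open>i < \<omega>\<^sub>1\<close>: an element of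
  \<open>\<nu>\<^sup>(\<^sup>i\<^sup>+\<^sup>1\<^sup>)\<close> is a countable set, and for limit \<open>i\<close> an element of \<open>\<nu>\<^sup>(\<^sup>i\<^sup>)\<close> is a
  family indexed by the ordinals below \<open>i\<close>, encoded as a function that is
  \<^const>\<open>undefined\<close> from \<open>i\<close> on.
\<close>

datatype elt =
    CSet (the_cset: "elt cset")
  | Family (the_family: "omega1 \<Rightarrow> elt")

definition members :: "elt \<Rightarrow> elt set" where
  "members x = rcset (the_cset x)"

definition component :: "elt \<Rightarrow> omega1 \<Rightarrow> elt" where
  "component x j = the_family x j"

definition Pc :: "elt set \<Rightarrow> elt set" where
  "Pc X = {CSet A | A. rcset A \<subseteq> X}"

definition Pc_map :: "(elt \<Rightarrow> elt) \<Rightarrow> elt \<Rightarrow> elt" where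
  "Pc_map f x = CSet (cimage f (the_cset x))"

lemma Pc_eq: "Pc X = (\<lambda>A. CSet (acset A)) ` {A. A \<subseteq> X \<and> countable A}"
proof (intro subset_antisym subsetI)
  fix x assume "x \<in> Pc X"
  then obtain B where "x = CSet B" "rcset B \<subseteq> X" unfolding Pc_def by blast
  then show "x \<in> (\<lambda>A. CSet (acset A)) ` {A. A \<subseteq> X \<and> countable A}"
    by (intro image_eqI[of _ _ "rcset B"]) (simp_all add: rcset_inverse)
next
  fix x assume "x \<in> (\<lambda>A. CSet (acset A)) ` {A. A \<subseteq> X \<and> countable A}"
  then obtain A where A: "x = CSet (acset A)" "A \<subseteq> X" "countable A" by blast
  then have "rcset (acset A) \<subseteq> X" by simp
  with A(1) show "x \<in> Pc X" unfolding Pc_def by blast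
qed

lemma members_CSet_acset [simp]: "countable A \<Longrightarrow> members (CSet (acset A)) = A"
  by (simp add: members_def)

lemma members_Pc_map [simp]: "members (Pc_map f x) = f ` members x"
  by (simp add: members_def Pc_map_def cimage.rep_eq)

lemma component_Family [simp]: "component (Family f) = f"
  by (simp add: component_def fun_eq_iff)

text \<open>
  \<open>conn i j\<close> is the connecting map \<open>\<nu>\<^sup>(\<^sup>i\<^sup>) \<rightarrow> \<nu>\<^sup>(\<^sup>j\<^sup>)\<close>, meaningful for \<open>j \<le> i\<close>. For limit
  \<open>j\<close> its value is forced by functoriality, since the \<open>k\<close>-th component of
  \<open>conn i j x\<close> is \<open>conn j k (conn i j x) = conn i k x\<close>. That \<open>nu\<close> and \<open>conn\<close>
  satisfy the clauses determining the final chain is shown below.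
\<close>

lemma restrict_fundef_cong [fundef_cong]:
  "I = J \<Longrightarrow> (\<And>i. i \<in> J \<Longrightarrow> f i = g i) \<Longrightarrow> restrict f I = restrict g J"
  by (auto simp: restrict_def)

function conn :: "omega1 \<Rightarrow> omega1 \<Rightarrow> elt \<Rightarrow> elt" where
  "conn i j x =
    (if limit j then Family (\<lambda>k\<in>{..<j}. conn i k x)
     else if limit i then component x j
     else Pc_map (\<lambda>y. conn (opred i) (opred j) y) x)"
  by pat_completeness auto
termination
  by (relation "inv_image {(j, j'). j < j'} (\<lambda>(i, j, x). j)") (auto simp: opred_less wf)

declare conn.simps [simp del]

function nu :: "omega1 \<Rightarrow> elt set" where
  "nu i =
    (if limit i then
       {Family x | x. x \<in> extensional {..<i} \<and> (\<forall>j<i. x j \<in> nu j) \<and>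
          (\<forall>j<i. \<forall>k\<le>j. conn j k (x j) = x k)}
     else Pc (nu (opred i)))"
  by pat_completeness auto
termination
  by (relation "{(j, j'). j < j'}") (auto simp: opred_less wf)

declare nu.simps [simp del]

theorem nu_osucc: "nu (osucc i) = Pc (nu i)"
  by (simp add: nu.simps[of "osucc i"])

theorem nu_limit:
  assumes "limit i"
  shows "nu i = {Family x | x. x \<in> (\<Pi>\<^sub>E j\<in>{..<i}. nu j) \<and>
                   (\<forall>j<i. \<forall>k\<le>j. conn j k (x j) = x k)}"
  using assms by (auto simp: nu.simps[of i] PiE_iff)

lemma nu_zero: "nu 0 = {Family (\<lambda>_. undefined)}"
proof -
  have "\<not> i < 0" for i :: omega1 by (simp add: not_less)
  then show ?thesis by (auto simp: nu_limit[OF limit_zero] lessThan_def)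
qed

theorem conn_osucc: "conn (osucc i) (osucc j) = Pc_map (conn i j)"
  by (simp add: fun_eq_iff conn.simps[of "osucc i" "osucc j"])

theorem conn_limit:
  assumes "limit i" "j < i" "x \<in> nu i"
  shows "conn i j x = component x j"
  using assms
proof (induction j arbitrary: i x rule: less_induct)
  case (less j)
  obtain f where f: "x = Family f" "\<And>l. l < i \<Longrightarrow> f l \<in> nu l"
    "\<And>l k. l < i \<Longrightarrow> k \<le> l \<Longrightarrow> conn l k (f l) = f k"
    using less.prems by (auto simp: nu.simps[of i])
  show ?case
  proof (cases "limit j")
    case False
    then show ?thesis using less.prems by (simp add: conn.simps[of i j])
  next
    case True
    have "f j \<in> nu j" using f less.prems by blast
    then obtain g where g: "f j = Family g" "g \<in> extensional {..<j}"
      using True by (auto simp: nu.simps[of j])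
    have "conn i k x = g k" if "k < j" for k
    proof -
      have "conn i k x = f k"
        using less.IH[OF that less.prems(1) _ less.prems(3)] that less.prems f(1) by simp
      also have "\<dots> = conn j k (f j)" using f(3)[of j k] that less.prems by simp
      also have "\<dots> = g k" using less.IH[OF that True that \<open>f j \<in> nu j\<close>] g by simp
      finally show ?thesis .
    qed
    then have "(\<lambda>k\<in>{..<j}. conn i k x) = g"
      using g(2) by (auto simp: fun_eq_iff extensional_def)
    then show ?thesis using True f g by (simp add: conn.simps[of i j])
  qed
qed

lemma nu_osuccE:
  assumes "x \<in> nu (osucc i)"
  obtains A where "x = CSet A" "rcset A \<subseteq> nu i"
  using assms by (auto simp: nu_osucc Pc_def)

lemma Pc_map_CSet: "Pc_map f (CSet A) = CSet (cimage f A)"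
  by (simp add: Pc_map_def)

theorem conn_id: "x \<in> nu i \<Longrightarrow> conn i i x = x"
proof (induction i arbitrary: x rule: less_induct)
  case (less i)
  show ?case
  proof (cases "limit i")
    case True
    obtain f where f: "x = Family f" "f \<in> extensional {..<i}"
      using less.prems True by (auto simp: nu.simps[of i])
    have "(\<lambda>k\<in>{..<i}. conn i k x) = f"
      using conn_limit[OF True _ less.prems] f by (auto simp: fun_eq_iff extensional_def)
    then show ?thesis using True f by (simp add: conn.simps[of i i])
  next
    case False
    then obtain j where j: "i = osucc j" by (rule not_limitE)
    then obtain A where A: "x = CSet A" "rcset A \<subseteq> nu j"
      using less.prems by (auto elim: nu_osuccE)
    have "conn j j ` rcset A = rcset A"
      using A(2) less.IH[of j] j by (force simp: subset_iff)
    then have "cimage (conn j j) A = A"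
      by (simp add: rcset_inject[symmetric] cimage.rep_eq)
    then show ?thesis using A j by (simp add: conn_osucc Pc_map_CSet)
  qed
qed

theorem conn_comp:
  assumes "k \<le> j" "j \<le> i" "x \<in> nu i"
  shows "conn j k (conn i j x) = conn i k x"
  using assms
proof (induction k arbitrary: i j x rule: less_induct)
  case (less k)
  show ?case
  proof (cases "limit k")
    case True
    have "conn j l (conn i j x) = conn i l x" if "l < k" for l
      using less.IH[OF that, of j i x] that less.prems by simp
    then have "(\<lambda>l\<in>{..<k}. conn j l (conn i j x)) = (\<lambda>l\<in>{..<k}. conn i l x)"
      by (auto simp: fun_eq_iff)
    then show ?thesis using True
      by (simp add: conn.simps[of i k] conn.simps[of j k])
  next
    case False
    then obtain k' where k': "k = osucc k'" by (rule not_limitE)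
    show ?thesis
    proof (cases "limit j")
      case True
      then have "k < j" using less.prems False by (metis order.order_iff_strict)
      then show ?thesis using True False by (simp add: conn.simps[of i j] conn.simps[of j k])
    next
      case jF: False
      then obtain j' where j': "j = osucc j'" by (rule not_limitE)
      show ?thesis
      proof (cases "limit i")
        case True
        then have "j < i" using less.prems jF by (metis order.order_iff_strict)
        obtain f where f: "x = Family f"
          "\<And>l k. l < i \<Longrightarrow> k \<le> l \<Longrightarrow> conn l k (f l) = f k"
          using less.prems True by (auto simp: nu.simps[of i])
        have "conn i j x = f j" "conn i k x = f k"
          using conn_limit[OF True _ less.prems(3)] \<open>j < i\<close> less.prems f by auto
        then show ?thesis using f(2)[OF \<open>j < i\<close> less.prems(1)] by simp
      next
        case False
        then obtain i' where i': "i = osucc i'" by (rule not_limitE)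
        then obtain A where A: "x = CSet A" "rcset A \<subseteq> nu i'"
          using less.prems by (auto elim: nu_osuccE)
        have "k' \<le> j'" "j' \<le> i'" using less.prems by (auto simp: i' j' k')
        then have "conn j' k' ` conn i' j' ` rcset A = conn i' k' ` rcset A"
          using A(2) less.IH[of k' j' i'] k'
          by (auto simp: image_image subset_iff intro!: image_cong)
        then have "cimage (conn j' k') (cimage (conn i' j') A) = cimage (conn i' k') A"
          by (simp add: rcset_inject[symmetric] cimage.rep_eq)
        then show ?thesis using A by (simp add: i' j' k' conn_osucc Pc_map_CSet)
      qed
    qed
  qed
qed

theorem conn_in_nu:
  assumes "j \<le> i" "x \<in> nu i"
  shows "conn i j x \<in> nu j"
  using assms
proof (induction j arbitrary: i x rule: less_induct)
  case (less j)
  show ?case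
  proof (cases "limit j")
    case True
    have "conn i k x \<in> nu k" if "k < j" for k
      using less.IH[OF that, of i x] that less.prems by simp
    moreover have "conn k l (conn i k x) = conn i l x" if "k < j" "l \<le> k" for k l
      using conn_comp[of l k i x] that less.prems by simp
    ultimately show ?thesis using True
      by (auto simp: conn.simps[of i j] nu.simps[of j] restrict_def extensional_def)
  next
    case False
    then obtain j' where j': "j = osucc j'" by (rule not_limitE)
    show ?thesis
    proof (cases "limit i")
      case True
      then have "j < i" using less.prems False by (metis order.order_iff_strict)
      then show ?thesis using True less.prems conn_limit[OF True \<open>j < i\<close> less.prems(2)]
        by (auto simp: nu.simps[of i])
    next
      case False
      then obtain i' where i': "i = osucc i'" by (rule not_limitE)
      then obtain A where A: "x = CSet A" "rcset A \<subseteq> nu i'"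
        using less.prems by (auto elim: nu_osuccE)
      have "conn i' j' ` rcset A \<subseteq> nu j'"
        using A(2) less.IH[of j' i'] less.prems by (auto simp: i' j')
      then show ?thesis using A
        by (auto simp: i' j' conn_osucc Pc_map_CSet nu_osucc Pc_def cimage.rep_eq)
    qed
  qed
qed


section \<open>Successors of an element\<close>

text \<open>Used for limit \<open>i\<close> only, so that \<open>osucc j < i\<close> whenever \<open>j < i\<close>.\<close>

definition successor :: "omega1 \<Rightarrow> elt \<Rightarrow> elt \<Rightarrow> bool" where
  "successor i a b \<longleftrightarrow> a \<in> nu i \<and> b \<in> nu i \<and>
     (\<forall>j<i. component b j \<in> members (component a (osucc j)))"

end

theory Submission
  imports Defs
begin

text \<open>
  A value \<open>CSet A\<close> can be read as a hereditarily countable well-founded set, and every such set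
  unfolds to an element of \<open>\<nu>\<^sup>(\<^sup>i\<^sup>)\<close> for each \<open>i\<close>. In \<open>\<nu>\<^sup>(\<^sup>j\<^sup>)\<close> the von Neumann ordinals below \<open>j\<close>
  stay distinct while all those from \<open>j\<close> on are identified. Take a strictly increasing cofinal
  sequence \<open>h\<close> in \<open>i\<close>. The sets \<open>h ` S\<close> for \<open>S \<subseteq> \<omega>\<close> are distinguished in \<open>\<nu>\<^sup>(\<^sup>i\<^sup>)\<close>, but at each stage
  \<open>j < i\<close> only finitely many elements of \<open>h ` S\<close> are distinguishable, so \<open>h ` S\<close> looks like \<open>h ` S'\<close> for
  some finite \<open>S'\<close>. Hence the countable set of all \<open>h ` S'\<close> with \<open>S'\<close> finite has all the
  \<open>2\<^sup>\<aleph>\<^sup>0\<close> sets \<open>h ` S\<close> as successors. There are no more, because \<open>\<nu>\<^sup>(\<^sup>i\<^sup>)\<close> has at most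
  \<open>2\<^sup>\<aleph>\<^sup>0\<close> elements.
\<close>

section \<open>Well-founded sets in the final chain\<close>

text \<open>The selector \<open>the_cset\<close> makes all of \<open>elt\<close> a coalgebra for the
  functor, and \<open>approx\<close> is the canonical cone from it to the final chain.\<close>

function approx :: "omega1 \<Rightarrow> elt \<Rightarrow> elt" where
  "approx i x =
    (if limit i then Family (\<lambda>k\<in>{..<i}. approx k x)
     else Pc_map (\<lambda>y. approx (opred i) y) x)"
  by pat_completeness auto
termination
  by (relation "inv_image {(j, j'). j < j'} fst") (auto simp: opred_less wf)

declare approx.simps [simp del]

lemma approx_osucc: "approx (osucc i) x = Pc_map (approx i) x"
  by (simp add: approx.simps[of "osucc i"])

lemma members_approx_osucc [simp]: "members (approx (osucc i) x) = approx i ` members x"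
  by (simp add: approx_osucc)

lemma Pc_map_eq_iff: "Pc_map f x = Pc_map g y \<longleftrightarrow> f ` members x = g ` members y"
  by (auto simp: Pc_map_def members_def rcset_inject[symmetric] cimage.rep_eq)

lemma component_approx: "limit i \<Longrightarrow> j < i \<Longrightarrow> component (approx i x) j = approx j x"
  by (simp add: approx.simps[of i])

lemma conn_approx: "j \<le> i \<Longrightarrow> conn i j (approx i x) = approx j x"
proof (induction j arbitrary: i x rule: less_induct)
  case (less j)
  show ?case
  proof (cases "limit j")
    case True
    have "(\<lambda>k\<in>{..<j}. conn i k (approx i x)) = (\<lambda>k\<in>{..<j}. approx k x)"
      using less by (intro restrict_ext) auto
    then show ?thesis
      using True by (simp add: conn.simps[of i j] approx.simps[of j])
  next
    case False
    then obtain j' where j': "j = osucc j'" by (rule not_limitE)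
    show ?thesis
    proof (cases "limit i")
      case True
      then have "j < i" using less.prems False by (metis order.order_iff_strict)
      then show ?thesis
        using True False by (simp add: conn.simps[of i j] component_approx)
    next
      case False
      then obtain i' where i': "i = osucc i'" by (rule not_limitE)
      then have "conn i' j' (approx i' y) = approx j' y" for y
        using less.IH[of j' i'] less.prems j' by simp
      then show ?thesis
        by (simp add: i' j' conn_osucc approx_osucc Pc_map_eq_iff image_image)
    qed
  qed
qed

lemma approx_in_nu: "approx i x \<in> nu i"
proof (induction i arbitrary: x rule: less_induct)
  case (less i)
  show ?case
  proof (cases "limit i")
    case True
    define y where "y = (\<lambda>k\<in>{..<i}. approx k x)"
    have "y \<in> (\<Pi>\<^sub>E j\<in>{..<i}. nu j)"
      using less.IH by (simp add: y_def PiE_iff)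
    moreover have "\<forall>j<i. \<forall>k\<le>j. conn j k (y j) = y k"
      by (auto simp: y_def conn_approx dest: le_less_trans)
    moreover have "approx i x = Family y"
      using True by (simp add: y_def approx.simps[of i])
    ultimately show ?thesis
      unfolding nu_limit[OF True] by blast
  next
    case False
    then obtain i' where i': "i = osucc i'" by (rule not_limitE)
    then have "approx i' y \<in> nu i'" for y
      using less less_osucc by blast
    then have "approx i' ` rcset (the_cset x) \<subseteq> nu i'"
      by blast
    then show ?thesis
      by (auto simp: i' nu_osucc approx_osucc Pc_def Pc_map_def cimage.rep_eq)
  qed
qed

text \<open>The member of \<open>x\<close> that agrees with \<open>y\<close> at stage
  \<open>j\<close> may vary with \<open>j\<close>, so \<open>y\<close> can be a successor without
  agreeing with any one member at all stages.\<close>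

lemma successor_approx_iff:
  assumes "limit i"
  shows "successor i (approx i x) (approx i y) \<longleftrightarrow>
    (\<forall>j<i. approx j y \<in> approx j ` members x)"
  using assms
  by (auto simp: successor_def approx_in_nu component_approx limit_osucc_less)

section \<open>Von Neumann ordinals at each stage\<close>

function ordn :: "omega1 \<Rightarrow> elt" where
  "ordn \<alpha> = CSet (acset (ordn ` {..<\<alpha>}))"
  by pat_completeness auto
termination
  by (relation "{(j, j'). j < j'}") (auto simp: wf)

declare ordn.simps [simp del]

lemma members_ordn [simp]: "members (ordn \<alpha>) = ordn ` {..<\<alpha>}"
  by (simp add: ordn.simps[of \<alpha>] countable_omega1_below)

text \<open>At stage \<open>osucc k\<close>, induction identifies every member of either ordinal,
  seen at stage \<open>k\<close>, with an ordinal up to \<open>k\<close>. Both sides thus have the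
  same members.\<close>

lemma approx_ordn_eq: "j \<le> \<alpha> \<Longrightarrow> approx j (ordn \<alpha>) = approx j (ordn j)"
proof (induction j arbitrary: \<alpha> rule: less_induct)
  case (less j)
  show ?case
  proof (cases "limit j")
    case True
    have "approx k (ordn \<alpha>) = approx k (ordn j)" if "k < j" for k
      using less.IH[OF that, of \<alpha>] less.IH[OF that, of j] that less.prems by simp
    then have "(\<lambda>k\<in>{..<j}. approx k (ordn \<alpha>)) = (\<lambda>k\<in>{..<j}. approx k (ordn j))"
      by (intro restrict_ext) auto
    then show ?thesis
      using True by (simp add: approx.simps[of j])
  next
    case False
    then obtain k where k: "j = osucc k" by (rule not_limitE)
    have "\<exists>\<gamma>'\<le>k. approx k (ordn \<gamma>) = approx k (ordn \<gamma>')" for \<gamma>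
      using less.IH[of k \<gamma>] k by (cases "\<gamma> \<le> k") auto
    then have "(\<lambda>\<gamma>. approx k (ordn \<gamma>)) ` {..<\<alpha>} = (\<lambda>\<gamma>. approx k (ordn \<gamma>)) ` {..k}"
      using less.prems k by (fastforce simp: image_iff)
    moreover have "{..<j} = {..k}"
      using k by auto
    ultimately show ?thesis
      by (simp add: k approx_osucc Pc_map_eq_iff image_image)
  qed
qed

text \<open>If the two agreed at stage \<open>osucc k\<close>, then \<alpha>, being a member of
  \<beta>, would agree at stage \<open>k\<close> with some \<gamma> below \<alpha>, against the
  induction hypothesis. A limit stage has \<open>osucc \<alpha>\<close> as an earlier stage, which
  already separates them.\<close>

lemma approx_ordn_neq: "\<alpha> < j \<Longrightarrow> \<alpha> < \<beta> \<Longrightarrow> approx j (ordn \<alpha>) \<noteq> approx j (ordn \<beta>)"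
proof (induction j arbitrary: \<alpha> \<beta> rule: less_induct)
  case (less j)
  show ?case
  proof (cases "limit j")
    case True
    then have "osucc \<alpha> < j"
      using less.prems by (simp add: limit_osucc_less)
    then show ?thesis
      using less.IH[of "osucc \<alpha>" \<alpha> \<beta>] less.prems component_approx[OF True]
      by (metis less_osucc)
  next
    case False
    then obtain k where k: "j = osucc k" by (rule not_limitE)
    show ?thesis
    proof
      assume "approx j (ordn \<alpha>) = approx j (ordn \<beta>)"
      then have "approx k ` members (ordn \<alpha>) = approx k ` members (ordn \<beta>)"
        by (metis k members_approx_osucc)
      moreover have "approx k (ordn \<alpha>) \<in> approx k ` members (ordn \<beta>)"
        using less.prems by auto
      ultimately have "approx k (ordn \<alpha>) \<in> approx k ` members (ordn \<alpha>)"
        by simp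
      then obtain \<gamma> where "\<gamma> < \<alpha>" "approx k (ordn \<alpha>) = approx k (ordn \<gamma>)"
        by auto
      moreover from this have "\<gamma> < k"
        using less.prems k by (metis less_osucc_iff less_le_trans)
      ultimately show False
        using less.IH[of k \<gamma> \<alpha>] k by simp
    qed
  qed
qed

lemma approx_osucc_ordn_inject: "approx (osucc \<alpha>) (ordn \<alpha>) = approx (osucc \<alpha>) (ordn \<beta>) \<Longrightarrow> \<alpha> = \<beta>"
  using approx_ordn_neq[of \<alpha> "osucc \<alpha>" \<beta>] approx_ordn_neq[of \<beta> "osucc \<alpha>" \<alpha>]
  by (metis less_osucc linorder_less_linear order.strict_trans)

section \<open>Countable sets of ordinals\<close>

definition ordset :: "omega1 set \<Rightarrow> elt" where
  "ordset T = CSet (acset (ordn ` T))"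

lemma members_ordset [simp]: "countable T \<Longrightarrow> members (ordset T) = ordn ` T"
  by (simp add: ordset_def)

lemma approx_ordset_subset:
  assumes "limit i" "T \<subseteq> {..<i}" "U \<subseteq> {..<i}"
    and eq: "approx i (ordset T) = approx i (ordset U)"
  shows "T \<subseteq> U"
proof
  fix \<beta> assume "\<beta> \<in> T"
  have cnt: "countable T" "countable U"
    using assms countable_omega1_below countable_subset by blast+
  \<comment> \<open>One successor step passes from a set to its members, the other makes the stage
    late enough to separate \<beta> from all other ordinals.\<close>
  have "osucc (osucc \<beta>) < i"
    using assms \<open>\<beta> \<in> T\<close> by (auto intro!: limit_osucc_less simp del: osucc_le_iff)
  then have "approx (osucc (osucc \<beta>)) (ordset T) = approx (osucc (osucc \<beta>)) (ordset U)"
    using eq component_approx[OF \<open>limit i\<close>] by metis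
  then have "approx (osucc \<beta>) ` ordn ` T = approx (osucc \<beta>) ` ordn ` U"
    using cnt by (metis members_approx_osucc members_ordset)
  moreover have "approx (osucc \<beta>) (ordn \<beta>) \<in> approx (osucc \<beta>) ` ordn ` T"
    using \<open>\<beta> \<in> T\<close> by blast
  ultimately obtain \<gamma> where "\<gamma> \<in> U" "approx (osucc \<beta>) (ordn \<beta>) = approx (osucc \<beta>) (ordn \<gamma>)"
    by auto
  then show "\<beta> \<in> U"
    using approx_osucc_ordn_inject by blast
qed

lemma approx_ordset_finite:
  fixes h :: "nat \<Rightarrow> omega1"
  assumes "mono h" "j \<le> h m"
  shows "\<exists>S'. finite S' \<and> approx j (ordset (h ` S)) = approx j (ordset (h ` S'))"
proof -
  define f where "f n = approx j (ordn (h n))" for n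
  \<comment> \<open>From \<open>m\<close> on, \<open>h\<close> is at least \<open>j\<close>, and all
    such ordinals coincide at stage \<open>j\<close>. Hence \<open>f\<close> has finite
    range.\<close>
  have "f n = f m" if "m \<le> n" for n
    using approx_ordn_eq[of j "h n"] approx_ordn_eq[of j "h m"] assms monoD[OF assms(1) that]
    by (simp add: f_def)
  then have "f n \<in> f ` {..m}" for n
    by (metis atMost_iff imageI nle_le order_refl)
  then have "f ` S \<subseteq> f ` {..m}"
    by blast
  then have "finite (f ` S)"
    by (rule finite_subset) simp
  then obtain S' where S': "finite S'" "f ` S' = f ` S"
    by (metis finite_subset_image order_refl)
  \<comment> \<open>Stage \<open>osucc j\<close> compares the sets by the images of their members at
    stage \<open>j\<close>; the connecting map then brings the equality down to
    \<open>j\<close>.\<close>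
  have "approx (osucc j) (ordset (h ` S)) = approx (osucc j) (ordset (h ` S'))"
    using S'(2) by (simp add: approx_osucc Pc_map_eq_iff image_image f_def)
  then have "approx j (ordset (h ` S)) = approx j (ordset (h ` S'))"
    using conn_approx[of j "osucc j"] by (metis less_osucc less_imp_le)
  then show ?thesis
    using S' by blast
qed

section \<open>Cofinal sequences\<close>

lemma cofinal_sequence:
  fixes i :: omega1
  assumes "limit i" "0 < i"
  obtains h :: "nat \<Rightarrow> omega1" where "strict_mono h" "range h \<subseteq> {..<i}" "\<And>j. j < i \<Longrightarrow> \<exists>m. j \<le> h m"
proof -
  define g where "g = from_nat_into {..<i}"
  have g: "range g = {..<i}"
    unfolding g_def using assms countable_omega1_below by (intro range_from_nat_into) auto
  \<comment> \<open>The successor makes \<open>h\<close> strictly increasing, and dominating the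
    enumeration \<open>g\<close> makes it cofinal.\<close>
  define h where "h = rec_nat (g 0) (\<lambda>n x. max (osucc x) (g (Suc n)))"
  have h: "h 0 = g 0" "h (Suc n) = max (osucc (h n)) (g (Suc n))" for n
    by (simp_all add: h_def)
  have gi: "g n < i" for n
    using g by auto
  have "h n < i" for n
    by (induction n) (use gi assms limit_osucc_less in \<open>auto simp: h\<close>)
  moreover have "strict_mono h"
    by (rule strict_mono_Suc_iff[THEN iffD2]) (simp add: h less_max_iff_disj)
  moreover have "g n \<le> h n" for n
    by (cases n) (simp_all add: h)
  then have "\<exists>m. j \<le> h m" if "j < i" for j
    using g that by (metis imageE lessThan_iff)
  ultimately show thesis
    using that by blast
qed

section \<open>The cardinality of the final chain\<close>

lemma Pc_lepoll:
  assumes "X \<lesssim> (UNIV :: nat set set)"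
  shows "Pc X \<lesssim> (UNIV :: nat set set)"
proof -
  obtain g :: "nat set \<Rightarrow> elt" where g: "X \<subseteq> range g"
    using assms by (auto simp: lepoll_iff)
  \<comment> \<open>One set of naturals codes a countable set: the pair of \<open>n\<close> and
    \<open>0\<close> says that index \<open>n\<close> is used, and the pairs of \<open>n\<close> and
    \<open>Suc k\<close> list the elements \<open>k\<close> of the code of the \<open>n\<close>-th
    member. By \<open>lepoll_iff\<close> it suffices that this decoding is onto.\<close>
  define G where "G S = CSet (acset ((\<lambda>n. g {k. prod_encode (n, Suc k) \<in> S}) `
    {n. prod_encode (n, 0) \<in> S}))" for S
  have "CSet (acset A) \<in> range G" if A: "A \<subseteq> X" "countable A" for A
  proof -
    obtain s where s: "\<And>x. x \<in> A \<Longrightarrow> g (s x) = x"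
      using g A by (metis image_iff subset_iff)
    define e where "e = to_nat_on A"
    have e: "inj_on e A"
      using A by (simp add: e_def inj_on_to_nat_on)
    define S where "S = {prod_encode (e x, 0) | x. x \<in> A} \<union>
      {prod_encode (e x, Suc k) | x k. x \<in> A \<and> k \<in> s x}"
    have N: "{n. prod_encode (n, 0) \<in> S} = e ` A"
      by (auto simp: S_def)
    have "{k. prod_encode (e x, Suc k) \<in> S} = s x" if "x \<in> A" for x
      using that inj_onD[OF e] by (auto simp: S_def)
    then have "(\<lambda>n. g {k. prod_encode (n, Suc k) \<in> S}) ` e ` A = A"
      using s by (simp add: image_image)
    then have "G S = CSet (acset A)"
      by (simp add: G_def N)
    then show ?thesis
      by (metis rangeI)
  qed
  then have "Pc X \<subseteq> range G"
    by (auto simp: Pc_eq)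
  then show ?thesis
    by (auto simp: lepoll_iff)
qed

lemma nu_lepoll: "nu i \<lesssim> (UNIV :: nat set set)"
proof (induction i rule: less_induct)
  case (less i)
  show ?case
  proof (cases "limit i")
    case False
    then obtain i' where "i = osucc i'" by (rule not_limitE)
    then show ?thesis
      using less[of i'] by (simp add: nu_osucc Pc_lepoll)
  next
    case True
    have "\<forall>j. \<exists>g :: nat set \<Rightarrow> elt. j < i \<longrightarrow> nu j \<subseteq> range g"
      using less by (auto simp: lepoll_iff)
    then obtain g :: "omega1 \<Rightarrow> nat set \<Rightarrow> elt" where g: "\<And>j. j < i \<Longrightarrow> nu j \<subseteq> range (g j)"
      by metis
    define e where "e = to_nat_on {..<i}"
    have e: "inj_on e {..<i}"
      using countable_omega1_below by (simp add: e_def inj_on_to_nat_on)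
    \<comment> \<open>As \<open>i\<close> is countable, one set of naturals holds a code for every
      component, the one at \<open>j\<close> being the slice with first coordinate
      \<open>e j\<close>.\<close>
    define G where "G S = Family (\<lambda>j\<in>{..<i}. g j {k. prod_encode (e j, k) \<in> S})" for S
    have "Family x \<in> range G" if x: "x \<in> (\<Pi>\<^sub>E j\<in>{..<i}. nu j)" for x
    proof -
      have "x j \<in> range (g j)" if "j < i" for j
        using g[OF that] x that by (blast dest: PiE_mem)
      then have "\<forall>j. \<exists>T. j < i \<longrightarrow> g j T = x j"
        by (metis imageE)
      then obtain s where s: "\<And>j. j < i \<Longrightarrow> g j (s j) = x j"
        by metis
      define S where "S = {prod_encode (e j, k) | j k. j < i \<and> k \<in> s j}"
      have S: "{k. prod_encode (e j, k) \<in> S} = s j" if "j < i" for j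
        using that inj_onD[OF e] by (auto simp: S_def)
      have "(\<lambda>j\<in>{..<i}. g j {k. prod_encode (e j, k) \<in> S}) = x"
      proof (rule extensionalityI[OF restrict_extensional])
        show "x \<in> extensional {..<i}"
          using x by (simp add: PiE_iff)
      qed (simp add: S s)
      then have "G S = Family x"
        by (simp add: G_def)
      then show ?thesis
        by (metis rangeI)
    qed
    then have "nu i \<subseteq> range G"
      by (auto simp: nu_limit[OF True])
    then show ?thesis
      by (auto simp: lepoll_iff)
  qed
qed

section \<open>Counting the successors\<close>

theorem proposition7p2:
  fixes i :: omega1
  assumes "limit i" and "0 < i"
  shows "\<exists>a \<in> nu i. {b. successor i a b} \<approx> (UNIV :: nat set set)"
proof -
  obtain h :: "nat \<Rightarrow> omega1" where h: "strict_mono h" "range h \<subseteq> {..<i}"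
    "\<And>j. j < i \<Longrightarrow> \<exists>m. j \<le> h m"
    using cofinal_sequence[OF assms] by blast
  define w where "w S = ordset (h ` S)" for S
  define a where "a = CSet (acset (w ` Collect finite))"
  have a: "members a = w ` Collect finite"
    by (simp add: a_def countable_Collect_finite)
  \<comment> \<open>Given \<open>j\<close>, cofinality supplies \<open>m\<close> with
    \<open>j\<close> at most \<open>h m\<close>, and the finite set that replaces \<open>S\<close>
    at this stage gives a member of \<open>a\<close>.\<close>
  have "successor i (approx i a) (approx i (w S))" for S
    unfolding successor_approx_iff[OF \<open>limit i\<close>] a w_def
    using approx_ordset_finite[OF strict_mono_mono[OF h(1)]] h(3) by (metis imageI mem_Collect_eq)
  moreover have "inj (\<lambda>S. approx i (w S))"
  proof (rule injI)
    fix S S' assume "approx i (w S) = approx i (w S')"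
    moreover have "h ` S \<subseteq> {..<i}" "h ` S' \<subseteq> {..<i}"
      using h(2) by auto
    ultimately have "h ` S = h ` S'"
      using approx_ordset_subset[OF \<open>limit i\<close>] unfolding w_def by (intro subset_antisym) simp_all
    then show "S = S'"
      using strict_mono_imp_inj_on[OF h(1)] by (simp add: inj_image_eq_iff)
  qed
  ultimately have "(UNIV :: nat set set) \<lesssim> {b. successor i (approx i a) b}"
    unfolding lepoll_def by blast
  moreover have "{b. successor i (approx i a) b} \<subseteq> nu i"
    by (auto simp: successor_def)
  then have "{b. successor i (approx i a) b} \<lesssim> (UNIV :: nat set set)"
    using nu_lepoll subset_imp_lepoll lepoll_trans by blast
  ultimately show ?thesis
    using approx_in_nu lepoll_antisym by blast
qed

end
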